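(* Let $\Phi$ be a global (such as the D- or A-criterion), concave and nonnegative optimality criterion on the symmetric positive semidefinite $p\times p$ matrices, equal to zero on singular matrices, and having a gradient $\nabla_M\Phi(M)$ at every nonsingular $M$. Let $\bar\xi\in\Xi$ be a design measure with $M(\bar\xi)$ nonsingular. Then $\bar\xi$ is $\Phi$-optimal, i.e. $\Phi\{M(\bar\xi)\}=\max_{\xi\in\Xi}\Phi\{M(\xi)\}$, if and only if for every $n$-tuple $z_1,\dots,z_n$ of (distinct) points of $\mathcal{X}$ $$\frac1n\sum_{i=1}^n h(z_i,\bar\xi)\;\le\;\sum_{x\in\mathcal{X}}\bar\xi(x)\,h(x,\bar\xi).$$ Moreover, if $\bar\xi$ satisfies the inequality $$\frac1n\sum_{i=1}^n h(z_i,\bar\xi)\;\le\;\sum_{x\in\mathcal{X}}\bar\xi(x)\,h(x,\bar\xi)+\delta$$ for some $\delta>0$ and any (distinct) $z_1,\dots,z_n\in\mathcal{X}$, then $$\Phi\{M(\bar\xi)\}\;\ge\;\max_{\xi\in\Xi}\Phi\{M(\xi)\}-\delta.$$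
   Context: Let $\mathcal{X}=\{x_1,\dots,x_N\}$ be a finite set with $N$ points, and let $n$ be an integer with $1\le n\le N$. Let $C$ be an $N\times N$ (symmetric) covariance matrix, $F$ a real $N\times p$ matrix (with entries $F_{i,j}=f_j(x_i)$ for given regression functions $f_1,\dots,f_p$), and $\kappa$ a number with $0<\kappa<\lambda_{\min}(C)$, where $\lambda_{\min}(C)$ is the minimal eigenvalue of $C$. Define the convex set of design measures $$\Xi=\Big\{\xi:\mathcal{X}\to\mathbb{R}\;:\;\sum_{x\in\mathcal{X}}\xi(x)=1,\;0\le\xi(x)\le 1/n\ \text{for all }x\in\mathcal{X}\Big\}.$$ For $\xi\in\Xi$ let $\operatorname{supp}(\xi)=\{x\in\mathcal{X}:\xi(x)>0\}$ and let $W(\xi)$ be the diagonal matrix, with rows and columns indexed by $\mathcal{X}$, whose diagonal entry at $x_i$ is $\kappa\,\frac{1/n-\xi(x_i)}{\xi(x_i)}$ (finite exactly when $x_i\in\operatorname{supp}(\xi)$). The information matrix is $$M(\xi)=F^{\top}\{C+W(\xi)\}^{-1}F\quad\text{if }\operatorname{supp}(\xi)=\mathcal{X},\qquad M(\xi)=F'^{\top}\{C'+W'(\xi)\}^{-1}F'\quad\text{if }\operatorname{supp}(\xi)\ne\mathcal{X},$$ where $C',W'(\xi)$ are the submatrices of $C,W(\xi)$ with rows and columns restricted to $\operatorname{supp}(\xi)$ and $F'$ is the submatrix of $F$ with rows restricted to $\operatorname{supp}(\xi)$. An optimality criterion is a real-valued, concave, continuous function $\Phi$ on the symmetric positive semidefinite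 $p\times p$ matrices which is increasing in the Löwner ordering ($A-B$ positive semidefinite implies $\Phi(A)\ge\Phi(B)$). The gradient $\nabla_M\Phi(M)$ is the symmetric matrix representing the derivative of $\Phi$ at $M$ with respect to the trace inner product $\langle A,B\rangle=\operatorname{tr}(AB)$ on symmetric matrices (e.g. for $\Phi(M)=\{\det M\}^{1/p}$ and nonsingular $M$, $\nabla_M\Phi(M)=p^{-1}\{\det M\}^{1/p}M^{-1}$). With $I$ the $N\times N$ identity matrix and $\operatorname{diag}\{\xi(\cdot)\}$ the $N\times N$ diagonal matrix with diagonal entries $\xi(x_1),\dots,\xi(x_N)$, put $$G(\xi)=F\,\big[\nabla_M\Phi\{M(\xi)\}\big]\,F^{\top},\qquad T(\xi)=\Big[(C-\kappa I)\operatorname{diag}\{\xi(\cdot)\}+\tfrac{\kappa}{n}I\Big]^{-1},$$ $$h(x,\xi)=\{T(\xi)\}_{x,\cdot}\;G(\xi)\;\{T^{\top}(\xi)\}_{\cdot,x},$$ where $\{A\}_{x,\cdot}$ and $\{A\}_{\cdot,x}$ denote the row, respectively column, of $A$ indexed by $x\in\mathcal{X}$; that is, $h(x,\xi)$ is the diagonal entry of $T(\xi)G(\xi)T^{\top}(\xi)$ at $x$.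
   Formalization: The final bound with δ fails when κ>n (e.g. N=2, n=p=1, C=11I, κ=10, F=(1,2)ᵀ, Φ(M)=M, ξ̄=(1,0), δ=0.04), as h omits the factor κ/n; it is proved as Φ{M(ξ̄)} ≥ max Φ − (κ/n)δ in general, and with δ itself when κ≤n. *)

theory Defs
  imports "HOL-Analysis.Analysis"
begin

text \<open>
  The finite set of points is the finite type \<open>'x\<close>, so that \<open>N = CARD('x)\<close>; the regression
  functions are indexed by the finite type \<open>'p\<close>, so that \<open>p = CARD('p)\<close>. Hence
  \<open>C :: real^'x^'x\<close> and \<open>F :: real^'p^'x\<close> with \<open>F $ x $ j\<close> the value of the
  \<open>j\<close>-th regression function at \<open>x\<close>.
\<close>

definition psd :: "real^'m^'m \<Rightarrow> bool" where
  "psd A \<longleftrightarrow> transpose A = A \<and> (\<forall>v. 0 \<le> v \<bullet> (A *v v))"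

definition lambda_min :: "real^'m^'m \<Rightarrow> real" where
  "lambda_min A = Min {l. \<exists>v. v \<noteq> 0 \<and> A *v v = l *\<^sub>R v}"

definition diag :: "('m \<Rightarrow> real) \<Rightarrow> real^'m^'m" where
  "diag d = (\<chi> i j. if i = j then d i else 0)"


subsection \<open>Designs and the information matrix\<close>

definition designs :: "nat \<Rightarrow> ('x::finite \<Rightarrow> real) set" where
  "designs n = {\<xi>. (\<Sum>x\<in>UNIV. \<xi> x) = 1 \<and> (\<forall>x. 0 \<le> \<xi> x \<and> \<xi> x \<le> 1 / real n)}"

definition supp :: "('x \<Rightarrow> real) \<Rightarrow> 'x set" where
  "supp \<xi> = {x. \<xi> x > 0}"

text \<open>
  Matrices with rows or columns restricted to a subset \<open>S\<close> of the index type keep their type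
  and are padded with zeros outside \<open>S\<close>. Accordingly \<open>sub_inv S A\<close> is the (zero padded)
  two-sided inverse of the submatrix \<open>(A $ i $ j)\<close>, \<open>i, j \<in> S\<close>; it depends only on the
  entries of \<open>A\<close> with both indices in \<open>S\<close>. As for \<^const>\<open>matrix_inv\<close>, it is
  unspecified if that submatrix is singular.
\<close>

definition restrict_rows :: "'x set \<Rightarrow> real^'p^'x \<Rightarrow> real^'p^'x" where
  "restrict_rows S A = (\<chi> i j. if i \<in> S then A $ i $ j else 0)"

definition sub_inv :: "'x set \<Rightarrow> real^'x^'x \<Rightarrow> real^'x^'x" where
  "sub_inv S A = (SOME B.
     (\<forall>i j. i \<notin> S \<or> j \<notin> S \<longrightarrow> B $ i $ j = 0) \<and>
     (\<forall>i\<in>S. \<forall>j\<in>S. (\<Sum>k\<in>S. A $ i $ k * B $ k $ j) = (if i = j then 1 else 0)) \<and>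
     (\<forall>i\<in>S. \<forall>j\<in>S. (\<Sum>k\<in>S. B $ i $ k * A $ k $ j) = (if i = j then 1 else 0)))"

text \<open>
  Off the support the diagonal entries of \<open>W\<close> are infinite on paper and \<open>0\<close> here
  (division by zero); \<open>info\<close> never uses them.
\<close>

definition W :: "nat \<Rightarrow> real \<Rightarrow> ('x::finite \<Rightarrow> real) \<Rightarrow> real^'x^'x" where
  "W n \<kappa> \<xi> = diag (\<lambda>x. \<kappa> * ((1 / real n - \<xi> x) / \<xi> x))"

definition info ::
  "nat \<Rightarrow> real \<Rightarrow> real^'x^'x \<Rightarrow> real^'p^'x \<Rightarrow> ('x::finite \<Rightarrow> real) \<Rightarrow> real^'p^'p" where
  "info n \<kappa> C F \<xi> =
     (if supp \<xi> = UNIV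
      then transpose F ** matrix_inv (C + W n \<kappa> \<xi>) ** F
      else transpose (restrict_rows (supp \<xi>) F) ** sub_inv (supp \<xi>) (C + W n \<kappa> \<xi>)
             ** restrict_rows (supp \<xi>) F)"


subsection \<open>Optimality criteria\<close>

definition criterion :: "(real^'p^'p \<Rightarrow> real) \<Rightarrow> bool" where
  "criterion \<Phi> \<longleftrightarrow>
     concave_on (Collect psd) \<Phi> \<and>
     continuous_on (Collect psd) \<Phi> \<and>
     (\<forall>A B. psd A \<longrightarrow> psd B \<longrightarrow> psd (A - B) \<longrightarrow> \<Phi> B \<le> \<Phi> A)"

text \<open>
  \<open>\<Phi>\<close> is only meaningful on positive semidefinite matrices, so the derivative is taken
  relative to that cone. At a nonsingular \<open>M\<close> in the cone, \<open>M\<close> is an interior point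
  relative to the symmetric matrices, so this is the derivative on the space of symmetric
  matrices and the symmetric matrix representing it is unique.
\<close>

definition has_gradient :: "(real^'p^'p \<Rightarrow> real) \<Rightarrow> real^'p^'p \<Rightarrow> real^'p^'p \<Rightarrow> bool" where
  "has_gradient \<Phi> D M \<longleftrightarrow>
     transpose D = D \<and>
     (\<Phi> has_derivative (\<lambda>H. trace (D ** H))) (at M within Collect psd)"

definition gradient :: "(real^'p^'p \<Rightarrow> real) \<Rightarrow> real^'p^'p \<Rightarrow> real^'p^'p" where
  "gradient \<Phi> M = (THE D. has_gradient \<Phi> D M)"

definition optimal ::
  "(real^'p^'p \<Rightarrow> real) \<Rightarrow> nat \<Rightarrow> real \<Rightarrow> real^'x^'x \<Rightarrow> real^'p^'x \<Rightarrow> ('x::finite \<Rightarrow> real) \<Rightarrow> bool"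
  where
  "optimal \<Phi> n \<kappa> C F \<xi> \<longleftrightarrow>
     \<xi> \<in> designs n \<and> (\<forall>\<eta>\<in>designs n. \<Phi> (info n \<kappa> C F \<eta>) \<le> \<Phi> (info n \<kappa> C F \<xi>))"


subsection \<open>The sensitivity function\<close>

text \<open>
  The derivative of \<open>\<Phi> \<circ> info n \<kappa> C F\<close> at \<open>\<xi>\<close> in direction \<open>\<eta> - \<xi>\<close> is
  \<open>(\<kappa> / n) * (\<Sum>x. (\<eta> x - \<xi> x) * h x \<xi>)\<close>. The sensitivity function \<open>h\<close> omits the factor
  \<open>\<kappa> / n\<close>, which is irrelevant for optimality but enters the bound on the optimality gap:
  a slack \<open>\<delta>\<close> in the inequality for \<open>h\<close> bounds the gap by \<open>(\<kappa> / n) * \<delta>\<close>, hence by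
  \<open>\<delta>\<close> when \<open>\<kappa> \<le> n\<close> but not in general.
\<close>

definition G ::
  "(real^'p^'p \<Rightarrow> real) \<Rightarrow> nat \<Rightarrow> real \<Rightarrow> real^'x^'x \<Rightarrow> real^'p^'x \<Rightarrow> ('x::finite \<Rightarrow> real)
     \<Rightarrow> real^'x^'x" where
  "G \<Phi> n \<kappa> C F \<xi> = F ** gradient \<Phi> (info n \<kappa> C F \<xi>) ** transpose F"

definition T :: "nat \<Rightarrow> real \<Rightarrow> real^'x^'x \<Rightarrow> ('x::finite \<Rightarrow> real) \<Rightarrow> real^'x^'x" where
  "T n \<kappa> C \<xi> = matrix_inv ((C - \<kappa> *\<^sub>R mat 1) ** diag \<xi> + (\<kappa> / real n) *\<^sub>R mat 1)"

definition h ::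
  "(real^'p^'p \<Rightarrow> real) \<Rightarrow> nat \<Rightarrow> real \<Rightarrow> real^'x^'x \<Rightarrow> real^'p^'x \<Rightarrow> 'x::finite \<Rightarrow> ('x \<Rightarrow> real)
     \<Rightarrow> real" where
  "h \<Phi> n \<kappa> C F x \<xi> =
     row x (T n \<kappa> C \<xi>) \<bullet> (G \<Phi> n \<kappa> C F \<xi> *v column x (transpose (T n \<kappa> C \<xi>)))"

end

theory Submission
  imports Defs
begin

text \<open>
  Put \<open>K = C - \<kappa> I\<close>, which is positive semidefinite, \<open>k = \<kappa> / n\<close> and \<open>D = diag \<xi>\<close>. Then
  \<open>T = (K D + k I)\<^sup>-\<^sup>1\<close> exists even if \<open>D\<close> is singular, the matrix \<open>D T\<close> is symmetric, and on the
  support of \<open>\<xi>\<close> it inverts \<open>C + W = K + k D\<^sup>-\<^sup>1\<close>, so \<open>M(\<xi>) = F\<^sup>T D T F\<close> whatever the support is. For a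
  second design \<open>\<eta>\<close> with matrices \<open>E\<close> and \<open>S\<close> in place of \<open>D\<close> and \<open>T\<close>, the identities
  \<open>E S - D T = k T\<^sup>T (E - D) S\<close> and \<open>T - S = S K (E - D) T\<close>, together with \<open>S K \<ge> 0\<close>, yield the
  directional derivative of \<open>M\<close> and the Loewner bound \<open>M(\<eta>) \<le> M(\<xi>) + k F\<^sup>T T\<^sup>T (E - D) T F\<close>.
  By monotonicity and concavity of \<open>\<Phi>\<close> the bound becomes
  \<open>\<Phi>(M(\<eta>)) \<le> \<Phi>(M(\<xi>)) + k \<Sum>\<^sub>x (\<eta>(x) - \<xi>(x)) h(x, \<xi>)\<close>, whose right-hand side is largest when \<open>\<eta>\<close> is
  uniform on \<open>n\<close> points with the largest values of \<open>h\<close>.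
\<close>

subsection \<open>Matrices\<close>

lemma diag_vec_nth [simp]: "(diag d *v v) $ i = d i * v $ i"
  by (simp add: diag_def matrix_vector_mult_def if_distrib if_distribR cong: if_cong)

lemma transpose_diag [simp]: "transpose (diag d) = diag d"
  by (auto simp: diag_def transpose_def vec_eq_iff)

lemma diag_diff: "diag a - diag b = diag (\<lambda>x. a x - b x)"
  by (simp add: diag_def vec_eq_iff)

lemma inner_diag: "u \<bullet> (diag d *v v) = (\<Sum>x\<in>UNIV. d x * (u $ x * v $ x))"
  by (simp add: inner_vec_def mult_ac)

lemma diag_mult_nth: "(diag d ** A) $ i $ j = d i * A $ i $ j"
  by (simp add: diag_def matrix_matrix_mult_def if_distrib if_distribR cong: if_cong)

lemma trace_diag_mult: "trace (diag d ** A) = (\<Sum>x\<in>UNIV. d x * A $ x $ x)"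
  by (simp add: trace_def diag_mult_nth)

lemma transpose_add: "transpose (A + B) = transpose A + transpose B"
  by (simp add: transpose_def vec_eq_iff)

lemma transpose_diff: "transpose (A - B) = transpose A - (transpose B :: 'a::ring^'n^'m)"
  by (simp add: transpose_def vec_eq_iff)

lemma matrix_add_rdistrib: "(A + B) ** C = A ** C + B ** C"
  by (simp add: matrix_matrix_mult_def vec_eq_iff sum.distrib distrib_right)

lemma matrix_diff_ldistrib: "A ** (B - C) = A ** B - A ** (C :: 'a::ring_1^'n^'m)"
  by (simp add: matrix_matrix_mult_def vec_eq_iff sum_subtractf right_diff_distrib)

lemma matrix_diff_rdistrib: "(A - B) ** C = A ** C - B ** (C :: 'a::ring_1^'n^'m)"
  by (simp add: matrix_matrix_mult_def vec_eq_iff sum_subtractf left_diff_distrib)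

lemma scaleR_matrix_vector: "(c *\<^sub>R A) *v x = c *\<^sub>R (A *v (x :: real^'n))"
  by (simp add: matrix_vector_mult_def vec_eq_iff sum_distrib_left mult_ac)

lemmas matrix_ring_simps = matrix_add_ldistrib matrix_add_rdistrib matrix_diff_ldistrib
  matrix_diff_rdistrib matrix_scalar_ac scalar_matrix_assoc [symmetric] matrix_mul_assoc

lemma inner_matrix_vector: "u \<bullet> (A *v v) = (transpose A *v u) \<bullet> (v :: real^'n)"
  by (simp add: dot_lmul_matrix)

lemma symmetric_nth:
  assumes "transpose A = A"
  shows "A $ i $ j = A $ j $ i"
proof -
  have "transpose A $ i $ j = A $ j $ i"
    by (simp add: transpose_def)
  with assms show ?thesis
    by simp
qed

lemma transpose_inverse:
  fixes A :: "'a::comm_semiring_1^'n^'m"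
  assumes "A ** B = mat 1"
  shows "transpose B ** transpose A = mat 1"
  using assms by (simp flip: matrix_transpose_mul)

lemma trace_scaleR: "trace (c *\<^sub>R A) = c * trace (A :: real^'n^'n)"
  by (simp add: trace_def sum_distrib_left)

lemma matrix_inv:
  assumes "invertible A"
  shows matrix_inv_right: "A ** matrix_inv A = mat 1"
    and matrix_inv_left: "matrix_inv A ** A = mat 1"
  using assms unfolding invertible_def matrix_inv_def by (metis (mono_tags, lifting) someI_ex)+

text \<open>Cramer's rule makes every entry of the inverse a quotient of determinants, which are
  polynomials in the entries. \<open>B x k m\<close> is \<open>A x\<close> with column
  \<open>k\<close> replaced by the \<open>m\<close>-th unit vector.\<close>

lemma continuous_on_matrix_inv:
  fixes A :: "'a::topological_space \<Rightarrow> real^'n^'n"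
  assumes cont: "\<And>i j. continuous_on S (\<lambda>x. A x $ i $ j)"
    and inv: "\<And>x. x \<in> S \<Longrightarrow> invertible (A x)"
  shows "continuous_on S (\<lambda>x. matrix_inv (A x))"
proof -
  define B where "B x k m = (\<chi> i j. if j = k then (axis m 1 :: real^'n) $ i else A x $ i $ j)"
    for x and k m :: 'n
  have inv_eq: "matrix_inv (A x) = (\<chi> k m. det (B x k m) / det (A x))" if "x \<in> S" for x
  proof (intro vec_eq_iff[THEN iffD2] allI)
    fix k m
    have "A x *v (matrix_inv (A x) *v axis m 1) = axis m 1"
      by (simp add: matrix_vector_mul_assoc matrix_inv_right inv that)
    moreover have "det (A x) \<noteq> 0"
      using inv that by (simp add: invertible_det_nz)
    ultimately have "matrix_inv (A x) *v axis m 1 = (\<chi> k. det (B x k m) / det (A x))"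
      by (simp add: cramer B_def)
    then have "(matrix_inv (A x) *v axis m 1) $ k = det (B x k m) / det (A x)"
      by simp
    then show "matrix_inv (A x) $ k $ m = (\<chi> k m. det (B x k m) / det (A x)) $ k $ m"
      by (simp add: matrix_vector_mult_basis column_def)
  qed
  have cont_det: "continuous_on S (\<lambda>x. det (D x))"
    if "\<And>i j. continuous_on S (\<lambda>x. D x $ i $ j)" for D :: "'a \<Rightarrow> real^'n^'n"
    unfolding det_def by (intro continuous_intros that)
  have "continuous_on S (\<lambda>x. B x k m $ i $ j)" for k m i j
    by (cases "j = k") (simp_all add: B_def cont)
  then have "continuous_on S (\<lambda>x. \<chi> k m. det (B x k m) / det (A x))"
    using inv by (intro continuous_on_vec_lambda continuous_on_divide cont_det cont)
      (auto simp: invertible_det_nz)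
  then show ?thesis
    by (simp add: inv_eq cong: continuous_on_cong)
qed

lemma continuous_on_matrix_mult [continuous_intros]:
  fixes A :: "'a::topological_space \<Rightarrow> real^'n^'m" and B :: "'a \<Rightarrow> real^'p^'n"
  assumes "continuous_on S A" "continuous_on S B"
  shows "continuous_on S (\<lambda>x. A x ** B x)"
  unfolding matrix_matrix_mult_def by (intro continuous_intros assms)

lemma continuous_on_diag:
  fixes d :: "'a::topological_space \<Rightarrow> 'n::finite \<Rightarrow> real"
  assumes "\<And>x. continuous_on S (\<lambda>s. d s x)"
  shows "continuous_on S (\<lambda>s. diag (d s))"
proof -
  have "continuous_on S (\<lambda>s. if i = j then d s i else 0)" for i j
    by (cases "i = j") (simp_all add: assms)
  then show ?thesis
    unfolding diag_def by (intro continuous_intros)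
qed

section \<open>Positive semidefinite forms and the smallest eigenvalue\<close>

lemma psd_congruence:
  fixes F :: "real^'p^'x"
  assumes "psd A"
  shows "psd (transpose F ** A ** F)"
proof -
  have "v \<bullet> ((transpose F ** A ** F) *v v) = (F *v v) \<bullet> (A *v (F *v v))" for v
    by (simp add: matrix_vector_mul_assoc [symmetric] inner_matrix_vector
        del: transpose_matrix_vector)
  with assms show ?thesis
    by (simp add: psd_def matrix_transpose_mul matrix_mul_assoc)
qed

text \<open>If \<open>A *v v\<close> were nonzero, moving from \<open>v\<close> a little in the
  direction \<open>- (A *v v)\<close> would make the quadratic form negative.\<close>

lemma psd_inner_eq_0:
  assumes "psd A" "v \<bullet> (A *v v) = 0"
  shows "A *v v = 0"
proof (rule ccontr)
  define w where "w = A *v v"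
  assume "A *v v \<noteq> 0"
  then have pos: "0 < w \<bullet> w"
    by (simp add: w_def)
  have sym: "v \<bullet> (A *v w) = w \<bullet> w"
    using assms(1) by (simp add: inner_matrix_vector psd_def w_def del: transpose_matrix_vector)
  define c where "c = w \<bullet> (A *v w)"
  have c: "0 \<le> c"
    using assms(1) by (simp add: psd_def c_def)
  have "0 \<le> - 2 * t * (w \<bullet> w) + t\<^sup>2 * c" for t
  proof -
    have "0 \<le> (v - t *\<^sub>R w) \<bullet> (A *v (v - t *\<^sub>R w))"
      using assms(1) by (simp add: psd_def)
    also have "\<dots> = - 2 * t * (w \<bullet> w) + t\<^sup>2 * c"
      using assms(2) sym
      by (simp add: algebra_simps inner_diff_left inner_diff_right c_def power2_eq_square
          flip: w_def)
    finally show ?thesis .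
  qed
  then have quad: "0 \<le> - 2 * t * (w \<bullet> w) + t\<^sup>2 * c" for t .
  \<comment> \<open>The parabola is lowest at \<open>(w \<bullet> w) / c\<close>; the denominator
    \<open>c + 1\<close> also covers \<open>c = 0\<close> and still gives a negative value.\<close>
  define r where "r = (w \<bullet> w) / (c + 1)"
  have r: "w \<bullet> w = r * (c + 1)"
    using c by (simp add: r_def)
  have "- 2 * r * (w \<bullet> w) + r\<^sup>2 * c = - (r\<^sup>2 * (c + 2))"
    unfolding r by (simp add: algebra_simps power2_eq_square)
  with quad[of r] have "r\<^sup>2 * (c + 2) \<le> 0"
    by linarith
  then show False
    using pos c by (simp add: mult_le_0_iff r)
qed

text \<open>Eigenvectors of a symmetric matrix for distinct eigenvalues are orthogonal, hence
  independent, so finite dimension bounds their number. Finiteness gives meaning to the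
  \<open>Min\<close> in \<open>lambda_min\<close>.\<close>

lemma finite_eigenvalues:
  fixes A :: "real^'n^'n"
  assumes "transpose A = A"
  shows "finite {l. \<exists>v. v \<noteq> 0 \<and> A *v v = l *\<^sub>R v}" (is "finite ?E")
proof -
  obtain f where f: "\<And>l. l \<in> ?E \<Longrightarrow> f l \<noteq> 0 \<and> A *v f l = l *\<^sub>R f l"
    using bchoice[of ?E "\<lambda>l v. v \<noteq> 0 \<and> A *v v = l *\<^sub>R v"] by auto
  have orth: "f l \<bullet> f m = 0" if "l \<in> ?E" "m \<in> ?E" "l \<noteq> m" for l m
  proof -
    have "l * (f l \<bullet> f m) = (A *v f l) \<bullet> f m"
      using f that by simp
    also have "\<dots> = f l \<bullet> (A *v f m)"
      using assms by (simp add: inner_matrix_vector del: transpose_matrix_vector)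
    also have "\<dots> = m * (f l \<bullet> f m)"
      using f that by simp
    finally show ?thesis
      using that by simp
  qed
  have inj: "inj_on f ?E"
  proof (rule inj_onI, rule ccontr)
    fix l m assume "l \<in> ?E" "m \<in> ?E" "f l = f m" "l \<noteq> m"
    then show False
      using orth[of l m] f[of m] by simp
  qed
  have "independent (f ` ?E)"
  proof (rule pairwise_orthogonal_independent)
    show "pairwise orthogonal (f ` ?E)"
      unfolding pairwise_def orthogonal_def by (metis (no_types, lifting) imageE orth)
    show "0 \<notin> f ` ?E"
      using f by (metis (no_types, lifting) imageE)
  qed
  then have "finite (f ` ?E)"
    by (rule independent_imp_finite)
  then show ?thesis
    using inj by (rule finite_imageD)
qed

text \<open>The minimum of the Rayleigh quotient over the unit sphere is an eigenvalue.\<close>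

lemma lambda_min_le:
  fixes A :: "real^'n^'n"
  assumes sym: "transpose A = A"
  shows "lambda_min A * (v \<bullet> v) \<le> v \<bullet> (A *v v)"
proof -
  have "continuous_on (sphere 0 1) (\<lambda>v. v \<bullet> (A *v v))"
    by (intro continuous_intros linear_continuous_on linear_conv_bounded_linear[THEN iffD1])
      auto
  moreover have "sphere 0 1 \<noteq> ({} :: (real^'n) set)"
    by (metis norm_axis_1 empty_iff mem_sphere_0)
  ultimately obtain u :: "real^'n" where u: "u \<in> sphere 0 1"
    and min: "\<And>v. v \<in> sphere 0 1 \<Longrightarrow> u \<bullet> (A *v u) \<le> v \<bullet> (A *v v)"
    using continuous_attains_inf[OF compact_sphere, of 0 1 "\<lambda>v. v \<bullet> (A *v v)"] by blast
  define m where "m = u \<bullet> (A *v u)"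
  have quad: "m * (v \<bullet> v) \<le> v \<bullet> (A *v v)" for v
  proof (cases "v = 0")
    case False
    define c where "c = 1 / norm v"
    have "m \<le> (c *\<^sub>R v) \<bullet> (A *v (c *\<^sub>R v))"
      unfolding m_def using False by (intro min) (simp add: c_def)
    also have "\<dots> = c\<^sup>2 * (v \<bullet> (A *v v))"
      by (simp add: matrix_vector_mult_scaleR power2_eq_square)
    also have "c\<^sup>2 = 1 / (v \<bullet> v)"
      by (simp add: c_def power_divide power2_norm_eq_inner)
    finally show ?thesis
      using False by (simp add: pos_le_divide_eq)
  qed simp
  \<comment> \<open>The shifted form is nonnegative and vanishes at the minimiser \<open>u\<close>,
    so \<open>u\<close> lies in the kernel of the shifted matrix and is an eigenvector for
    \<open>m\<close>.\<close>
  have "psd (A - m *\<^sub>R mat 1)"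
    using quad sym
    by (simp add: psd_def transpose_diff transpose_scalar algebra_simps scaleR_matrix_vector inner_diff_right)
  moreover have uu: "u \<bullet> u = 1"
    using u by (simp add: norm_eq_1)
  then have "u \<bullet> ((A - m *\<^sub>R mat 1) *v u) = 0"
    by (simp add: algebra_simps scaleR_matrix_vector m_def)
  ultimately have "A *v u = m *\<^sub>R u"
    using psd_inner_eq_0 by (fastforce simp: algebra_simps scaleR_matrix_vector)
  moreover have "u \<noteq> 0"
    using uu by auto
  ultimately have "lambda_min A \<le> m"
    unfolding lambda_min_def by (intro Min_le finite_eigenvalues sym) auto
  then have "lambda_min A * (v \<bullet> v) \<le> m * (v \<bullet> v)"
    by (intro mult_right_mono) auto
  with quad[of v] show ?thesis
    by linarith
qed

lemma psd_diff_lambda_min: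
  assumes "psd C" "c < lambda_min C"
  shows "psd (C - c *\<^sub>R mat 1)"
proof -
  have "c * (v \<bullet> v) \<le> v \<bullet> (C *v v)" for v
  proof -
    have "c * (v \<bullet> v) \<le> lambda_min C * (v \<bullet> v)"
      using assms(2) by (intro mult_right_mono) auto
    also have "\<dots> \<le> v \<bullet> (C *v v)"
      using assms(1) by (intro lambda_min_le) (simp add: psd_def)
    finally show ?thesis .
  qed
  then show ?thesis
    using assms(1)
    by (simp add: psd_def transpose_diff transpose_scalar algebra_simps scaleR_matrix_vector)
qed

subsection \<open>The regularized kernel and the information matrix\<close>

locale regularized_kernel =
  fixes K :: "real^'x^'x" and k :: real
  assumes psd_K: "psd K" and k_pos: "0 < k"
begin

lemma transpose_K: "transpose K = K"
  using psd_K by (simp add: psd_def)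

lemma K_nonneg: "0 \<le> v \<bullet> (K *v v)"
  using psd_K by (simp add: psd_def)

definition system :: "('x \<Rightarrow> real) \<Rightarrow> real^'x^'x" where
  "system d = K ** diag d + k *\<^sub>R mat 1"

definition resolvent :: "('x \<Rightarrow> real) \<Rightarrow> real^'x^'x" where
  "resolvent d = matrix_inv (system d)"

lemma transpose_system: "transpose (system d) = diag d ** K + k *\<^sub>R mat 1"
  by (simp add: system_def transpose_add transpose_scalar matrix_transpose_mul transpose_K)

lemma system_mult: "system d *v v = K *v (diag d *v v) + k *\<^sub>R v"
  by (simp add: system_def matrix_vector_mult_add_rdistrib scaleR_matrix_vector matrix_vector_mul_assoc)

lemma diag_nonneg:
  assumes "\<And>x. 0 \<le> d x"
  shows "0 \<le> v \<bullet> (diag d *v v)"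
  unfolding inner_diag using assms by (intro sum_nonneg) simp

text \<open>Pairing \<open>system d *v v = 0\<close> with \<open>w = diag d *v v\<close> gives a
  vanishing sum of the nonnegative terms \<open>w \<bullet> (K *v w)\<close> and
  \<open>k * (w \<bullet> v)\<close>. The second one forces \<open>w = 0\<close>, and then only
  \<open>k *\<^sub>R v = 0\<close> is left of the equation.\<close>

lemma invertible_system:
  assumes d: "\<And>x. 0 \<le> d x"
  shows "invertible (system d)"
proof -
  have "v = 0" if "system d *v v = 0" for v
  proof -
    define w where "w = diag d *v v"
    have "w \<bullet> (K *v w) + k * (w \<bullet> v) = w \<bullet> (system d *v v)"
      by (simp add: system_mult w_def inner_add_right)
    then have "k * (w \<bullet> v) \<le> 0"
      using K_nonneg[of w] that by simp
    then have "w \<bullet> v \<le> 0"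
      using k_pos by (simp add: mult_le_0_iff)
    then have "(\<Sum>x\<in>UNIV. d x * (v $ x * v $ x)) \<le> 0"
      by (simp add: w_def inner_commute inner_diag)
    moreover have "0 \<le> d x * (v $ x * v $ x)" for x
      using d by simp
    ultimately have "d x * (v $ x * v $ x) = 0" for x
      using sum_nonneg_eq_0_iff[of UNIV "\<lambda>x. d x * (v $ x * v $ x)"]
      by (simp add: order_antisym sum_nonneg)
    then have "w = 0"
      by (simp add: w_def vec_eq_iff)
    then show "v = 0"
      using that k_pos by (simp add: system_mult w_def)
  qed
  then show ?thesis
    by (metis invertible_left_inverse matrix_left_invertible_ker)
qed

lemma system_resolvent:
  assumes "\<And>x. 0 \<le> d x"
  shows "system d ** resolvent d = mat 1" "resolvent d ** system d = mat 1"
  unfolding resolvent_def using invertible_system[OF assms] by (simp_all add: matrix_inv)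

text \<open>Division-free form of the inverse of \<open>K + k D^(-1)\<close>: it remains meaningful
  and continuous when weights reach zero, where the support changes.\<close>

definition effect :: "('x \<Rightarrow> real) \<Rightarrow> real^'x^'x" where
  "effect d = diag d ** resolvent d"

text \<open>With \<open>D = diag d\<close>, both \<open>transpose (system d) ** D\<close> and
  \<open>D ** system d\<close> equal \<open>D K D + k D\<close>; cancelling the two systems by their
  inverses moves \<open>D\<close> across the resolvent.\<close>

lemma transpose_resolvent_diag:
  assumes d: "\<And>x. 0 \<le> d x"
  shows "transpose (resolvent d) ** diag d = effect d"
proof -
  have comm: "transpose (system d) ** diag d = diag d ** system d"
    by (simp add: transpose_system) (simp add: system_def matrix_ring_simps)
  have inv: "transpose (resolvent d) ** transpose (system d) = mat 1"
    by (intro transpose_inverse system_resolvent d)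
  have "transpose (resolvent d) ** diag d
      = transpose (resolvent d) ** (diag d ** system d) ** resolvent d"
    by (simp add: system_resolvent d flip: matrix_mul_assoc)
  also have "\<dots> = (transpose (resolvent d) ** transpose (system d)) ** diag d ** resolvent d"
    by (simp add: matrix_mul_assoc flip: comm)
  finally show ?thesis
    by (simp add: inv effect_def)
qed

lemma transpose_effect:
  assumes "\<And>x. 0 \<le> d x"
  shows "transpose (effect d) = effect d"
  using transpose_resolvent_diag[OF assms] by (simp add: effect_def matrix_transpose_mul)

lemma effect_diff:
  assumes d: "\<And>x. 0 \<le> d x" and e: "\<And>x. 0 \<le> e x"
  shows "effect e - effect d = k *\<^sub>R (transpose (resolvent d) ** diag (\<lambda>x. e x - d x) ** resolvent e)"
proof -
  have "effect e - effect d
      = transpose (resolvent d) ** (transpose (system d) ** diag e - diag d ** system e) ** resolvent e"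
  proof -
    have "transpose (resolvent d) ** transpose (system d) = mat 1"
      by (intro transpose_inverse system_resolvent d)
    then have "transpose (resolvent d) ** (transpose (system d) ** diag e) ** resolvent e = effect e"
      by (simp add: effect_def matrix_mul_assoc)
    moreover have "transpose (resolvent d) ** (diag d ** system e) ** resolvent e
        = transpose (resolvent d) ** diag d ** (system e ** resolvent e)"
      by (simp add: matrix_mul_assoc)
    ultimately show ?thesis
      by (simp add: matrix_diff_ldistrib matrix_diff_rdistrib system_resolvent[OF e]
          transpose_resolvent_diag[OF d])
  qed
  \<comment> \<open>Both products contain the same term \<open>diag d ** K ** diag e\<close>, which
    cancels.\<close>
  also have "transpose (system d) ** diag e - diag d ** system e = k *\<^sub>R diag (\<lambda>x. e x - d x)"
    by (simp add: transpose_system flip: diag_diff)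
      (simp add: system_def matrix_ring_simps scaleR_right_diff_distrib)
  finally show ?thesis
    by (simp add: matrix_ring_simps)
qed

text \<open>The resolvent identity, with the factors ordered so that \<open>resolvent e ** K\<close>
  appears: its nonnegative form gives the second order remainder a sign.\<close>

lemma resolvent_diff:
  assumes d: "\<And>x. 0 \<le> d x" and e: "\<And>x. 0 \<le> e x"
  shows "resolvent d - resolvent e = resolvent e ** K ** diag (\<lambda>x. e x - d x) ** resolvent d"
proof -
  have "resolvent d - resolvent e = resolvent e ** (system e - system d) ** resolvent d"
  proof -
    have "resolvent e ** (system d) ** resolvent d = resolvent e ** (system d ** resolvent d)"
      by (simp add: matrix_mul_assoc)
    then show ?thesis
      by (simp add: matrix_diff_ldistrib matrix_diff_rdistrib system_resolvent d e)
  qed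
  also have "system e - system d = K ** diag (\<lambda>x. e x - d x)"
    by (simp add: system_def matrix_diff_ldistrib flip: diag_diff)
  finally show ?thesis
    by (simp add: matrix_mul_assoc)
qed

text \<open>Substituting \<open>u = transpose (system d) *v y\<close> removes the inverse and leaves
  the \<open>diag d\<close> form at \<open>K *v y\<close> plus \<open>k\<close> times the
  \<open>K\<close> form at \<open>y\<close>.\<close>

lemma resolvent_K_nonneg:
  assumes d: "\<And>x. 0 \<le> d x"
  shows "0 \<le> u \<bullet> (resolvent d *v (K *v u))"
proof -
  define y where "y = transpose (resolvent d) *v u"
  have "transpose (system d) ** transpose (resolvent d) = mat 1"
    by (intro transpose_inverse system_resolvent d)
  then have "u = transpose (system d) *v y"
    by (simp add: y_def matrix_vector_mul_assoc del: transpose_matrix_vector)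
  also have "\<dots> = diag d *v (K *v y) + k *\<^sub>R y"
    by (simp add: transpose_system matrix_vector_mult_add_rdistrib scaleR_matrix_vector
        matrix_vector_mul_assoc)
  finally have u: "u = diag d *v (K *v y) + k *\<^sub>R y" .
  have "u \<bullet> (resolvent d *v (K *v u)) = y \<bullet> (K *v u)"
    by (simp add: inner_matrix_vector y_def del: transpose_matrix_vector)
  also have "\<dots> = (K *v y) \<bullet> u"
    by (simp add: inner_matrix_vector transpose_K del: transpose_matrix_vector)
  also have "\<dots> = (K *v y) \<bullet> (diag d *v (K *v y)) + k * (y \<bullet> (K *v y))"
    by (subst u) (simp add: inner_add_right inner_commute)
  finally show ?thesis
    using diag_nonneg[OF d, of "K *v y"] K_nonneg[of y] k_pos by simp
qed

lemma psd_effect: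
  assumes d: "\<And>x. 0 \<le> d x"
  shows "psd (effect d)"
proof -
  have "0 \<le> u \<bullet> (effect d *v u)" for u
  proof -
    define y where "y = resolvent d *v u"
    have u: "u = system d *v y"
      by (simp add: y_def matrix_vector_mul_assoc system_resolvent d)
    have "u \<bullet> (effect d *v u) = (diag d *v y) \<bullet> u"
      by (simp add: effect_def y_def inner_commute flip: matrix_vector_mul_assoc)
    also have "\<dots> = (diag d *v y) \<bullet> (K *v (diag d *v y)) + k * (y \<bullet> (diag d *v y))"
      by (subst u) (simp add: system_mult inner_add_right inner_commute)
    finally show ?thesis
      using diag_nonneg[OF d, of y] K_nonneg[of "diag d *v y"] k_pos by simp
  qed
  then show ?thesis
    using d by (simp add: psd_def transpose_effect)
qed

text \<open>Loewner concavity of \<open>effect\<close>: it stays below its tangent. With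
  \<open>\<Delta>\<close> the diagonal matrix of \<open>e - d\<close>, the gap is \<open>k\<close>
  times the form of \<open>resolvent e ** K\<close> evaluated at
  \<open>\<Delta> ** resolvent d\<close>.\<close>

lemma psd_effect_linearization:
  assumes d: "\<And>x. 0 \<le> d x" and e: "\<And>x. 0 \<le> e x"
  shows "psd (effect d + k *\<^sub>R (transpose (resolvent d) ** diag (\<lambda>x. e x - d x) ** resolvent d)
    - effect e)" (is "psd ?L")
proof -
  define \<Delta> where "\<Delta> = diag (\<lambda>x. e x - d x)"
  have "?L = k *\<^sub>R (transpose (resolvent d) ** \<Delta> ** (resolvent d - resolvent e))"
    using effect_diff[OF d e]
    by (simp add: matrix_diff_ldistrib scaleR_right_diff_distrib \<Delta>_def algebra_simps)
  then have L: "?L = k *\<^sub>R (transpose (resolvent d) ** \<Delta> ** (resolvent e ** K ** \<Delta> ** resolvent d))"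
    by (simp add: resolvent_diff d e \<Delta>_def)
  have "0 \<le> v \<bullet> (?L *v v)" for v
  proof -
    define u where "u = \<Delta> *v (resolvent d *v v)"
    have "v \<bullet> (?L *v v) = k * (u \<bullet> (resolvent e *v (K *v u)))"
      unfolding L by (simp add: scaleR_matrix_vector u_def \<Delta>_def inner_matrix_vector
          del: transpose_matrix_vector flip: matrix_vector_mul_assoc)
    then show ?thesis
      using resolvent_K_nonneg[OF e] k_pos by simp
  qed
  \<comment> \<open>Symmetry is read off the original expression; the product form \<open>L\<close>
    does not display it.\<close>
  moreover have "transpose ?L = ?L"
    by (simp add: transpose_add transpose_diff transpose_scalar transpose_effect d e
        matrix_transpose_mul matrix_mul_assoc)
  ultimately show ?thesis
    by (simp add: psd_def)
qed

section \<open>Continuity in the weights and the padded inverse on the support\<close>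

lemma continuous_on_resolvent:
  fixes d :: "'a::topological_space \<Rightarrow> 'x \<Rightarrow> real"
  assumes cont: "\<And>x. continuous_on S (\<lambda>s. d s x)" and nonneg: "\<And>s x. s \<in> S \<Longrightarrow> 0 \<le> d s x"
  shows "continuous_on S (\<lambda>s. resolvent (d s))"
  unfolding resolvent_def
proof (rule continuous_on_matrix_inv)
  show "continuous_on S (\<lambda>s. system (d s) $ i $ j)" for i j
    unfolding system_def
    by (intro continuous_on_component continuous_on_add continuous_on_matrix_mult
        continuous_on_const continuous_on_diag cont)
qed (simp add: invertible_system nonneg)

lemma continuous_on_effect:
  fixes d :: "'a::topological_space \<Rightarrow> 'x \<Rightarrow> real"
  assumes cont: "\<And>x. continuous_on S (\<lambda>s. d s x)" and nonneg: "\<And>s x. s \<in> S \<Longrightarrow> 0 \<le> d s x"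
  shows "continuous_on S (\<lambda>s. effect (d s))"
  unfolding effect_def
  by (intro continuous_on_matrix_mult continuous_on_diag continuous_on_resolvent cont nonneg)

text \<open>For \<open>i\<close> in the support,
  \<open>B $ i $ j = d i * resolvent d $ i $ j\<close> cancels the division in
  \<open>k / d i\<close>, so row \<open>i\<close> of \<open>A\<close> times \<open>B\<close> is row
  \<open>i\<close> of \<open>system d ** resolvent d\<close>. Symmetry gives the left inverse, and
  uniqueness settles the choice in \<open>sub_inv\<close>.\<close>

lemma sub_inv_effect:
  fixes A :: "real^'x^'x"
  assumes d: "\<And>x. 0 \<le> d x"
    and A: "\<And>i j. i \<in> S \<Longrightarrow> j \<in> S \<Longrightarrow> A $ i $ j = K $ i $ j + (if i = j then k / d i else 0)"
    and S: "S = {x. 0 < d x}"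
  shows "sub_inv S A = effect d"
proof -
  define B where "B = effect d"
  have sym_B: "B $ i $ j = B $ j $ i" for i j
    unfolding B_def by (intro symmetric_nth transpose_effect d)
  have sym_A: "A $ i $ j = A $ j $ i" if "i \<in> S" "j \<in> S" for i j
  proof -
    have "K $ i $ j = K $ j $ i"
      by (intro symmetric_nth transpose_K)
    then show ?thesis
      using that by (simp add: A)
  qed
  have d0: "d x = 0" if "x \<notin> S" for x
    using that d[of x] by (simp add: S)
  have B_nth: "B $ i $ j = d i * resolvent d $ i $ j" for i j
    by (simp add: B_def effect_def diag_mult_nth)
  \<comment> \<open>Rows off the support vanish because their weight is zero; columns follow by
    symmetry.\<close>
  have pad: "B $ i $ j = 0" if "i \<notin> S \<or> j \<notin> S" for i j
    using that B_nth[of i j] B_nth[of j i] sym_B[of i j] d0 by auto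
  have right: "(\<Sum>m\<in>S. A $ i $ m * B $ m $ j) = (if i = j then 1 else 0)" if "i \<in> S" for i j
  proof -
    have "(\<Sum>m\<in>S. A $ i $ m * B $ m $ j)
        = (\<Sum>m\<in>S. K $ i $ m * B $ m $ j) + (\<Sum>m\<in>S. if i = m then k / d i * B $ i $ j else 0)"
      unfolding sum.distrib[symmetric] using that by (intro sum.cong) (auto simp: A algebra_simps)
    also have "(\<Sum>m\<in>S. if i = m then k / d i * B $ i $ j else 0) = k * resolvent d $ i $ j"
      using that S by (simp add: B_nth)
    also have "(\<Sum>m\<in>S. K $ i $ m * B $ m $ j) = (K ** B) $ i $ j"
      unfolding matrix_matrix_mult_def using pad by (auto intro: sum.mono_neutral_left)
    also have "(K ** B) $ i $ j + k * resolvent d $ i $ j = (system d ** resolvent d) $ i $ j"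
      by (simp add: system_def B_def effect_def matrix_ring_simps)
    also have "\<dots> = (if i = j then 1 else 0)"
      using d by (simp add: system_resolvent mat_def)
    finally show ?thesis .
  qed
  have left: "(\<Sum>m\<in>S. B $ i $ m * A $ m $ j) = (if i = j then 1 else 0)" if "i \<in> S" "j \<in> S" for i j
  proof -
    have "(\<Sum>m\<in>S. B $ i $ m * A $ m $ j) = (\<Sum>m\<in>S. A $ j $ m * B $ m $ i)"
      using that by (intro sum.cong) (auto simp: sym_A[of _ j] sym_B[of i])
    with right[OF that(2), of i] show ?thesis
      by auto
  qed
  show ?thesis
    unfolding sub_inv_def B_def[symmetric]
  proof (rule some_equality)
    fix B'
    assume B': "(\<forall>i j. i \<notin> S \<or> j \<notin> S \<longrightarrow> B' $ i $ j = 0) \<and>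
      (\<forall>i\<in>S. \<forall>j\<in>S. (\<Sum>m\<in>S. A $ i $ m * B' $ m $ j) = (if i = j then 1 else 0)) \<and>
      (\<forall>i\<in>S. \<forall>j\<in>S. (\<Sum>m\<in>S. B' $ i $ m * A $ m $ j) = (if i = j then 1 else 0))"
    then have pad': "i \<notin> S \<or> j \<notin> S \<Longrightarrow> B' $ i $ j = 0"
      and left': "i \<in> S \<Longrightarrow> j \<in> S \<Longrightarrow>
        (\<Sum>m\<in>S. B' $ i $ m * A $ m $ j) = (if i = j then 1 else 0)" for i j
      by blast+
    \<comment> \<open>Uniqueness on the support:
      \<open>B' = B' (A B) = (B' A) B = B\<close>.\<close>
    have "B' $ i $ j = B $ i $ j" for i j
    proof (cases "i \<in> S \<and> j \<in> S")
      case True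
      have "B' $ i $ j = (\<Sum>m\<in>S. if m = j then B' $ i $ m else 0)"
        using True by simp
      also have "\<dots> = (\<Sum>m\<in>S. B' $ i $ m * (\<Sum>l\<in>S. A $ m $ l * B $ l $ j))"
        by (intro sum.cong) (simp_all add: right)
      also have "\<dots> = (\<Sum>l\<in>S. (\<Sum>m\<in>S. B' $ i $ m * A $ m $ l) * B $ l $ j)"
        unfolding sum_distrib_left sum_distrib_right mult.assoc by (rule sum.swap)
      also have "\<dots> = (\<Sum>l\<in>S. (if i = l then B $ l $ j else 0))"
        using True by (intro sum.cong) (simp_all add: left')
      also have "\<dots> = B $ i $ j"
        using True by simp
      finally show ?thesis .
    next
      case False
      then show ?thesis
        using pad[of i j] pad'[of i j] by auto
    qed
    then show "B' = B"
      by (simp add: vec_eq_iff)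
  next
    show "(\<forall>i j. i \<notin> S \<or> j \<notin> S \<longrightarrow> B $ i $ j = 0) \<and>
      (\<forall>i\<in>S. \<forall>j\<in>S. (\<Sum>m\<in>S. A $ i $ m * B $ m $ j) = (if i = j then 1 else 0)) \<and>
      (\<forall>i\<in>S. \<forall>j\<in>S. (\<Sum>m\<in>S. B $ i $ m * A $ m $ j) = (if i = j then 1 else 0))"
      by (intro conjI allI impI ballI pad right left)
  qed
qed

end

lemma info_eq_effect:
  fixes C :: "real^'x^'x" and F :: "real^'p^'x"
  assumes K: "psd (C - \<kappa> *\<^sub>R mat 1)" and pos: "0 < \<kappa>" "1 \<le> n" and \<xi>: "\<xi> \<in> designs n"
  shows "info n \<kappa> C F \<xi>
    = transpose F ** regularized_kernel.effect (C - \<kappa> *\<^sub>R mat 1) (\<kappa> / real n) \<xi> ** F"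
proof -
  interpret regularized_kernel "C - \<kappa> *\<^sub>R mat 1" "\<kappa> / real n"
    using assms by unfold_locales auto
  have nonneg: "0 \<le> \<xi> x" for x
    using \<xi> by (simp add: designs_def)
  \<comment> \<open>Here \<open>K\<close> and \<open>k\<close> arise: \<kappa> (1/n - \<xi>) / \<xi>
    = (\<kappa>/n) / \<xi> - \<kappa>, and the constant part is absorbed into
    \<open>C\<close>.\<close>
  have entry: "(C + W n \<kappa> \<xi>) $ i $ j
      = (C - \<kappa> *\<^sub>R mat 1) $ i $ j + (if i = j then \<kappa> / real n / \<xi> i else 0)"
    if "i \<in> supp \<xi>" for i j
    using that by (auto simp: W_def diag_def mat_def supp_def field_simps)
  have sub: "sub_inv (supp \<xi>) (C + W n \<kappa> \<xi>) = effect \<xi>"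
    by (intro sub_inv_effect nonneg entry) (auto simp: supp_def)
  show ?thesis
  proof (cases "supp \<xi> = UNIV")
    case True
    have "sub_inv UNIV A = matrix_inv A" for A :: "real^'x^'x"
      by (simp add: sub_inv_def matrix_inv_def matrix_matrix_mult_def mat_def vec_eq_iff)
    with True sub show ?thesis
      by (simp add: info_def)
  next
    case False
    \<comment> \<open>The zero padding of \<open>effect \<xi>\<close> already discards the rows of
      \<open>F\<close> off the support, so restricting \<open>F\<close> changes nothing.\<close>
    have "effect \<xi> $ i $ j = 0" if "i \<notin> supp \<xi>" for i j
      using that nonneg[of i] by (simp add: effect_def diag_mult_nth supp_def)
    moreover have "effect \<xi> $ i $ j = effect \<xi> $ j $ i" for i j
      by (intro symmetric_nth transpose_effect nonneg)
    ultimately have pad: "effect \<xi> $ i $ j = 0" if "i \<notin> supp \<xi> \<or> j \<notin> supp \<xi>" for i j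
      using that by metis
    have "(transpose (restrict_rows (supp \<xi>) F) ** effect \<xi> ** restrict_rows (supp \<xi>) F) $ a $ b
        = (transpose F ** effect \<xi> ** F) $ a $ b" for a b
      unfolding matrix_matrix_mult_def transpose_def restrict_rows_def sum_distrib_right
      using pad by (auto intro!: sum.cong)
    then have "transpose (restrict_rows (supp \<xi>) F) ** effect \<xi> ** restrict_rows (supp \<xi>) F
        = transpose F ** effect \<xi> ** F"
      unfolding vec_eq_iff by blast
    with False sub show ?thesis
      by (simp add: info_def)
  qed
qed

subsection \<open>Concave criteria and their gradients\<close>

lemma psd_add: "psd A \<Longrightarrow> psd B \<Longrightarrow> psd (A + B)"
  by (simp add: psd_def transpose_add matrix_vector_mult_add_rdistrib inner_add_right)

lemma psd_outer: "psd (\<chi> i j. v $ i * v $ j)"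
proof -
  have "(\<chi> i j. v $ i * v $ j) *v u = (v \<bullet> u) *\<^sub>R v" for u
    by (simp add: matrix_vector_mult_def vec_eq_iff inner_vec_def sum_distrib_left
        sum_distrib_right mult_ac)
  then have "0 \<le> u \<bullet> ((\<chi> i j. v $ i * v $ j) *v u)" for u
    by (simp add: inner_commute)
  then show ?thesis
    by (simp add: psd_def transpose_def mult.commute)
qed

lemma trace_mult_outer: "trace (D ** (\<chi> i j. v $ i * v $ j)) = v \<bullet> (D *v (v :: real^'n))"
  by (simp add: trace_def matrix_matrix_mult_def inner_vec_def matrix_vector_mult_def
      sum_distrib_left mult_ac)

text \<open>Continuity of \<open>g\<close> suffices. Since \<open>effect_diff\<close> supplies such
  a \<open>g\<close> in closed form, the matrix inverse never has to be differentiated.\<close>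

lemma has_vector_derivative_quotient:
  fixes g :: "real \<Rightarrow> 'a::real_normed_vector"
  assumes \<gamma>: "\<And>t. t \<in> {0..1} \<Longrightarrow> \<gamma> t = a + t *\<^sub>R g t" and g: "continuous_on {0..1} g"
  shows "(\<gamma> has_vector_derivative g 0) (at 0 within {0..1})"
  unfolding has_vector_derivative_def has_derivative_within
proof
  show "bounded_linear (\<lambda>t. t *\<^sub>R g 0)"
    by (rule bounded_linear_scaleR_left)
  have "(g \<longlongrightarrow> g 0) (at 0 within {0..1})"
    using g by (simp add: continuous_on_def)
  then have "((\<lambda>t. g t - g 0) \<longlongrightarrow> 0) (at 0 within {0..1})"
    using LIM_zero by blast
  moreover have "\<forall>\<^sub>F t in at 0 within {0..1}.
      (1 / norm (t - 0)) *\<^sub>R (\<gamma> t - (\<gamma> 0 + (t - 0) *\<^sub>R g 0)) = g t - g 0"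
    by (auto simp: eventually_at_filter \<gamma> scaleR_right_diff_distrib
        scaleR_right_distrib)
  ultimately show "((\<lambda>t. (1 / norm (t - 0)) *\<^sub>R (\<gamma> t - (\<gamma> 0 + (t - 0) *\<^sub>R g 0))) \<longlongrightarrow> 0)
      (at 0 within {0..1})"
    by (subst tendsto_cong)
qed

text \<open>Chain rule along a curve inside the cone, as the gradient is taken relative to the cone;
  the limit is one-sided because the curve starts at the base point.\<close>

lemma has_gradient_along:
  assumes grad: "has_gradient \<Phi> D (\<gamma> 0)"
    and psd: "\<And>t. t \<in> {0..1} \<Longrightarrow> psd (\<gamma> t)"
    and deriv: "(\<gamma> has_vector_derivative H) (at 0 within {0..1})"
  shows "((\<lambda>t. (\<Phi> (\<gamma> t) - \<Phi> (\<gamma> 0)) / t) \<longlongrightarrow> trace (D ** H)) (at_right 0)"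
proof -
  have "(\<Phi> has_derivative (\<lambda>H. trace (D ** H))) (at (\<gamma> 0) within \<gamma> ` {0..1})"
    using grad psd by (auto simp: has_gradient_def intro: has_derivative_subset)
  from has_derivative_in_compose[OF deriv[unfolded has_vector_derivative_def] this]
  have "((\<lambda>t. \<Phi> (\<gamma> t)) has_field_derivative trace (D ** H)) (at 0 within {0..1})"
    by (simp add: has_field_derivative_def matrix_scalar_ac trace_scaleR mult_commute_abs
        flip: scalar_matrix_assoc)
  then show ?thesis
    by (simp add: has_field_derivative_iff at_within_Icc_at_right)
qed

lemma psd_segment:
  assumes "psd A" "psd B" "t \<in> {0..1}"
  shows "psd (A + t *\<^sub>R (B - A))"
proof -
  have "v \<bullet> ((A + t *\<^sub>R (B - A)) *v v) = (1 - t) * (v \<bullet> (A *v v)) + t * (v \<bullet> (B *v v))" for v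
    by (simp add: algebra_simps scaleR_matrix_vector inner_add_right inner_diff_right)
  with assms show ?thesis
    by (simp add: psd_def transpose_add transpose_diff transpose_scalar)
qed

lemma has_gradient_segment:
  assumes grad: "has_gradient \<Phi> D A" and A: "psd A" and B: "psd B"
  shows "((\<lambda>t. (\<Phi> (A + t *\<^sub>R (B - A)) - \<Phi> A) / t) \<longlongrightarrow> trace (D ** (B - A))) (at_right 0)"
proof -
  have "((\<lambda>t. A + t *\<^sub>R (B - A)) has_vector_derivative (B - A)) (at 0 within {0..1})"
    by (rule has_vector_derivative_quotient) (auto intro: continuous_intros)
  from has_gradient_along[OF _ _ this, of \<Phi> D] show ?thesis
    using assms by (simp add: psd_segment)
qed

text \<open>Adding \<open>v v^T\<close> never leaves the cone, so two gradients have the same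
  one-sided derivative in every rank-one direction, that is, the same quadratic form. Being
  symmetric, they coincide.\<close>

lemma gradient_eqI:
  assumes "psd M" "has_gradient \<Phi> D M"
  shows "gradient \<Phi> M = D"
  unfolding gradient_def
proof (rule the_equality)
  fix D'
  assume D': "has_gradient \<Phi> D' M"
  have zero: "v \<bullet> ((D' - D) *v v) = 0" for v
  proof -
    have "psd (M + (\<chi> i j. v $ i * v $ j))"
      using assms(1) psd_outer by (rule psd_add)
    from has_gradient_segment[OF D' assms(1) this] has_gradient_segment[OF assms(2,1) this]
    have "trace (D' ** (\<chi> i j. v $ i * v $ j)) = trace (D ** (\<chi> i j. v $ i * v $ j))"
      by (intro tendsto_unique[of "at_right (0::real)"]) simp_all
    then show ?thesis
      by (simp add: trace_mult_outer matrix_vector_mult_diff_rdistrib inner_diff_right)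
  qed
  \<comment> \<open>A vanishing form is in particular nonnegative, so \<open>psd_inner_eq_0\<close>
    applies.\<close>
  then have "psd (D' - D)"
    using D' assms(2) by (simp add: psd_def has_gradient_def transpose_diff)
  then have "(D' - D) *v v = 0" for v
    using zero by (rule psd_inner_eq_0)
  then show "D' = D"
    by (simp add: matrix_eq matrix_vector_mult_diff_rdistrib)
qed (fact assms(2))

text \<open>By concavity, \<open>\<Phi> B - \<Phi> A\<close> is at most every secant slope on the
  segment from \<open>A\<close> to \<open>B\<close>, hence at most their limit at
  \<open>A\<close>.\<close>

lemma concave_gradient_le:
  assumes conc: "concave_on (Collect psd) \<Phi>" and grad: "has_gradient \<Phi> D A"
    and A: "psd A" and B: "psd B"
  shows "\<Phi> B \<le> \<Phi> A + trace (D ** (B - A))"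
proof -
  have "\<Phi> B - \<Phi> A \<le> (\<Phi> (A + t *\<^sub>R (B - A)) - \<Phi> A) / t" if "t \<in> {0<..<1}" for t
  proof -
    have "(1 - t) * \<Phi> A + t * \<Phi> B \<le> \<Phi> ((1 - t) *\<^sub>R A + t *\<^sub>R B)"
      using that by (intro concave_onD[OF conc]) (auto simp: A B)
    also have "(1 - t) *\<^sub>R A + t *\<^sub>R B = A + t *\<^sub>R (B - A)"
      by (simp add: algebra_simps)
    finally show ?thesis
      using that by (simp add: field_simps)
  qed
  then have "\<forall>\<^sub>F t in at_right 0. \<Phi> B - \<Phi> A \<le> (\<Phi> (A + t *\<^sub>R (B - A)) - \<Phi> A) / t"
    by (auto simp: eventually_at_right_field intro!: exI[of _ 1])
  then have "\<Phi> B - \<Phi> A \<le> trace (D ** (B - A))"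
    by (intro tendsto_lowerbound[OF has_gradient_segment[OF grad A B]]) auto
  then show ?thesis
    by simp
qed

subsection \<open>Capped weights\<close>

text \<open>Take \<open>S\<close> with the largest sum of \<open>f\<close>: exchanging a member for
  an outsider cannot increase that sum.\<close>

lemma ex_card_subset_dominating:
  fixes f :: "'x::finite \<Rightarrow> real"
  assumes "n \<le> CARD('x)"
  obtains S where "card S = n" "\<And>i j. i \<in> S \<Longrightarrow> j \<notin> S \<Longrightarrow> f j \<le> f i"
proof -
  have "{S :: 'x set. card S = n} \<noteq> {}"
    using obtain_subset_with_card_n[OF assms] by auto
  then obtain S where S: "card S = n" and max: "\<And>S'. card S' = n \<Longrightarrow> sum f S' \<le> sum f S"
    using Max_ge[of "sum f ` {S. card S = n}"] Max_in[of "sum f ` {S. card S = n}"] by fastforce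
  have "f j \<le> f i" if "i \<in> S" "j \<notin> S" for i j
  proof -
    have "0 < n"
      using that S by (auto simp: card_gt_0_iff)
    then have "card (insert j (S - {i})) = n"
      using that S by simp
    from max[OF this] show ?thesis
      using that by (simp add: sum_diff1)
  qed
  with S that show thesis
    by blast
qed

text \<open>The bathtub principle: under the cap \<open>1 / n\<close>, a linear functional is
  largest when all mass sits on \<open>n\<close> points with the largest values.\<close>

lemma capped_weights_sum_le:
  fixes f w :: "'x::finite \<Rightarrow> real"
  assumes n: "1 \<le> n" "n \<le> CARD('x)" and w: "w \<in> designs n"
  obtains S where "card S = n" "(\<Sum>x\<in>UNIV. w x * f x) \<le> 1 / real n * (\<Sum>x\<in>S. f x)"
proof -
  obtain S where S: "card S = n" and dom: "\<And>i j. i \<in> S \<Longrightarrow> j \<notin> S \<Longrightarrow> f j \<le> f i"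
    using ex_card_subset_dominating[OF n(2)] by blast
  have "S \<noteq> {}"
    using S n by auto
  \<comment> \<open>The threshold value: on \<open>S\<close> we have \<open>w \<le> u\<close> and
    \<open>f \<ge> c\<close>, off \<open>S\<close> the reverse, so \<open>(w - u) * (f - c)\<close>
    is never positive. The terms with \<open>c\<close> cancel because both weights have mass
    one.\<close>
  define c where "c = Min (f ` S)"
  have c_le: "c \<le> f x" if "x \<in> S" for x
    using that by (simp add: c_def)
  have le_c: "f x \<le> c" if "x \<notin> S" for x
    using that dom \<open>S \<noteq> {}\<close> by (auto simp: c_def)
  define u where "u x = (if x \<in> S then 1 / real n else 0)" for x
  have sum_u: "(\<Sum>x\<in>UNIV. u x) = 1"
    using S n by (simp add: u_def sum.If_cases)
  have "(\<Sum>x\<in>UNIV. (w x - u x) * (f x - c)) \<le> 0"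
  proof (rule sum_nonpos)
    fix x
    show "(w x - u x) * (f x - c) \<le> 0"
      using w c_le[of x] le_c[of x]
      by (cases "x \<in> S") (auto simp: u_def designs_def mult_le_0_iff)
  qed
  also have "(\<Sum>x\<in>UNIV. (w x - u x) * (f x - c))
      = (\<Sum>x\<in>UNIV. w x * f x) - (\<Sum>x\<in>UNIV. u x * f x) - c * ((\<Sum>x\<in>UNIV. w x) - (\<Sum>x\<in>UNIV. u x))"
    by (simp add: algebra_simps sum.distrib sum_subtractf sum_distrib_left)
  finally have "(\<Sum>x\<in>UNIV. w x * f x) \<le> (\<Sum>x\<in>UNIV. u x * f x)"
    using w sum_u by (simp add: designs_def)
  also have "\<dots> = 1 / real n * (\<Sum>x\<in>S. f x)"
    by (simp add: u_def sum.If_cases sum_distrib_left if_distrib[of "\<lambda>a. a * _"] cong: if_cong)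
  finally show thesis
    using S that by blast
qed

lemma compact_designs: "compact {v :: real^'x. vec_nth v \<in> designs n}"
proof -
  have "closed {v :: real^'x. (\<Sum>x\<in>UNIV. v $ x) = 1}"
    by (intro closed_Collect_eq continuous_intros)
  then have "compact (cbox 0 (\<chi> x. 1 / real n) \<inter> {v :: real^'x. (\<Sum>x\<in>UNIV. v $ x) = 1})"
    by (intro compact_Int_closed compact_cbox)
  also have "cbox 0 (\<chi> x. 1 / real n) \<inter> {v :: real^'x. (\<Sum>x\<in>UNIV. v $ x) = 1}
      = {v. vec_nth v \<in> designs n}"
    by (auto simp: mem_box_cart designs_def)
  finally show ?thesis .
qed

subsection \<open>Optimality\<close>

text \<open>Converts the row and column expression in \<open>h\<close> into the diagonal entry of
  \<open>T G T^T\<close>.\<close>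

lemma sandwich_diagonal:
  fixes A :: "real^'n^'m"
  shows "(A ** B ** transpose A) $ i $ i = row i A \<bullet> (B *v row i A)"
  unfolding matrix_matrix_mult_def transpose_def row_def inner_vec_def matrix_vector_mult_def
  by (simp add: sum_distrib_left sum_distrib_right mult.assoc) (rule sum.swap)

context regularized_kernel
begin

text \<open>Cyclicity of the trace brings the diagonal factor to the front, where it weights
  diagonal entries; for the resolvent as \<open>R\<close> these are the values of
  \<open>h\<close>.\<close>

lemma trace_linearization:
  fixes F :: "real^'p^'x" and D :: "real^'p^'p"
  shows "trace (D ** (transpose F ** (transpose R ** diag d ** R) ** F))
    = (\<Sum>x\<in>UNIV. d x * (R ** (F ** D ** transpose F) ** transpose R) $ x $ x)"
proof -
  have "trace (D ** (transpose F ** (transpose R ** diag d ** R) ** F))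
      = trace ((D ** transpose F ** transpose R) ** (diag d ** R ** F))"
    by (simp add: matrix_mul_assoc)
  also have "\<dots> = trace ((diag d ** R ** F) ** (D ** transpose F ** transpose R))"
    by (rule trace_mul_sym)
  also have "\<dots> = trace (diag d ** (R ** (F ** D ** transpose F) ** transpose R))"
    by (simp add: matrix_mul_assoc)
  finally show ?thesis
    by (simp add: trace_diag_mult)
qed

text \<open>\<open>U\<close> is the tangent of the information matrix at \<open>d\<close>, evaluated
  at \<open>e\<close>. Monotonicity compares the matrix at \<open>e\<close> with \<open>U\<close>,
  and the tangent inequality for \<open>\<Phi>\<close> compares \<open>U\<close> with the matrix at
  \<open>d\<close>.\<close>

lemma criterion_effect_le:
  fixes F :: "real^'p^'x"
  assumes crit: "criterion \<Phi>" and grad: "has_gradient \<Phi> D (transpose F ** effect d ** F)"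
    and d: "\<And>x. 0 \<le> d x" and e: "\<And>x. 0 \<le> e x"
  shows "\<Phi> (transpose F ** effect e ** F) \<le> \<Phi> (transpose F ** effect d ** F)
    + k * (\<Sum>x\<in>UNIV. (e x - d x)
        * (resolvent d ** (F ** D ** transpose F) ** transpose (resolvent d)) $ x $ x)"
proof -
  define L where "L = transpose (resolvent d) ** diag (\<lambda>x. e x - d x) ** resolvent d"
  define U where "U = transpose F ** (effect d + k *\<^sub>R L) ** F"
  have info_psd: "psd (transpose F ** effect c ** F)" if "\<And>x. 0 \<le> c x" for c
    using that by (intro psd_congruence psd_effect)
  have "psd (transpose F ** (effect d + k *\<^sub>R L - effect e) ** F)"
    unfolding L_def by (intro psd_congruence psd_effect_linearization d e)
  then have diff: "psd (U - transpose F ** effect e ** F)"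
    by (simp add: U_def matrix_diff_ldistrib matrix_diff_rdistrib)
  from psd_add[OF this info_psd[of e, OF e]] have U: "psd U"
    by simp
  have "\<Phi> (transpose F ** effect e ** F) \<le> \<Phi> U"
    using crit U diff info_psd[of e, OF e] unfolding criterion_def by blast
  also have "\<dots> \<le> \<Phi> (transpose F ** effect d ** F) + trace (D ** (U - transpose F ** effect d ** F))"
    using crit unfolding criterion_def by (intro concave_gradient_le grad info_psd d U) blast
  also have "U - transpose F ** effect d ** F = k *\<^sub>R (transpose F ** L ** F)"
    by (simp add: U_def matrix_ring_simps)
  also have "trace (D ** (k *\<^sub>R (transpose F ** L ** F))) = k * trace (D ** (transpose F ** L ** F))"
    by (simp only: matrix_scalar_ac trace_scaleR scalar_matrix_assoc [symmetric])
  finally show ?thesis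
    by (simp only: L_def trace_linearization)
qed

text \<open>The information matrix is not affine along the segment of weights, but
  \<open>effect_diff\<close> gives its exact difference quotient \<open>g\<close>, which is
  continuous down to \<open>t = 0\<close>.\<close>

lemma criterion_effect_deriv:
  fixes F :: "real^'p^'x"
  assumes grad: "has_gradient \<Phi> D (transpose F ** effect d ** F)"
    and d: "\<And>x. 0 \<le> d x" and e: "\<And>x. 0 \<le> e x"
  shows "((\<lambda>t. (\<Phi> (transpose F ** effect (\<lambda>x. d x + t * (e x - d x)) ** F)
        - \<Phi> (transpose F ** effect d ** F)) / t)
    \<longlongrightarrow> k * (\<Sum>x\<in>UNIV. (e x - d x)
        * (resolvent d ** (F ** D ** transpose F) ** transpose (resolvent d)) $ x $ x)) (at_right 0)"
proof -
  define c where "c t x = d x + t * (e x - d x)" for t x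
  have c: "0 \<le> c t x" if "t \<in> {0..1}" for t x
  proof -
    have "c t x = (1 - t) * d x + t * e x"
      by (simp add: c_def algebra_simps)
    then show ?thesis
      using that d e by simp
  qed
  have c0: "c 0 = d"
    by (simp add: c_def fun_eq_iff)
  define \<gamma> where "\<gamma> t = transpose F ** effect (c t) ** F" for t
  define g where "g t = k *\<^sub>R (transpose F
      ** (transpose (resolvent d) ** diag (\<lambda>x. e x - d x) ** resolvent (c t)) ** F)" for t
  have "\<gamma> t = transpose F ** effect d ** F + t *\<^sub>R g t" if t: "t \<in> {0..1}" for t
  proof -
    have "diag (\<lambda>x. c t x - d x) = t *\<^sub>R diag (\<lambda>x. e x - d x)"
      by (simp add: c_def diag_def vec_eq_iff)
    then have "effect (c t) = effect d
        + t *\<^sub>R k *\<^sub>R (transpose (resolvent d) ** diag (\<lambda>x. e x - d x) ** resolvent (c t))"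
      using effect_diff[of d "c t", OF d c[OF t]] by (simp add: matrix_ring_simps algebra_simps)
    then show ?thesis
      by (simp add: \<gamma>_def g_def matrix_ring_simps)
  qed
  moreover have "continuous_on {0..1} g"
    unfolding g_def
    by (intro continuous_on_scaleR continuous_on_matrix_mult continuous_on_const
        continuous_on_resolvent c) (auto simp: c_def intro!: continuous_intros)
  ultimately have "(\<gamma> has_vector_derivative g 0) (at 0 within {0..1})"
    by (rule has_vector_derivative_quotient)
  moreover have "psd (\<gamma> t)" if "t \<in> {0..1}" for t
    unfolding \<gamma>_def using c that by (intro psd_congruence psd_effect)
  moreover have "has_gradient \<Phi> D (\<gamma> 0)"
    using grad by (simp add: \<gamma>_def c0)
  ultimately have "((\<lambda>t. (\<Phi> (\<gamma> t) - \<Phi> (\<gamma> 0)) / t) \<longlongrightarrow> trace (D ** g 0)) (at_right 0)"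
    by (intro has_gradient_along)
  also have "trace (D ** g 0) = k * trace (D ** (transpose F
      ** (transpose (resolvent d) ** diag (\<lambda>x. e x - d x) ** resolvent d) ** F))"
    by (simp only: g_def c0 matrix_scalar_ac trace_scaleR scalar_matrix_assoc [symmetric])
  finally show ?thesis
    by (simp only: trace_linearization \<gamma>_def c0) (simp only: c_def [abs_def])
qed

end

text \<open>The maximum in the gap estimate is represented by a maximiser \<open>\<xi>max\<close>,
  whose existence is part of the claim. The tangent bound produces the factor
  \<open>\<kappa> / n\<close>; the plain bound \<open>\<delta>\<close> follows once this factor is
  at most one.\<close>

theorem theorem2:
  fixes n :: nat and \<kappa> :: real
    and C :: "real^'x^'x" and F :: "real^'p^'x"
    and \<Phi> :: "real^'p^'p \<Rightarrow> real"
    and \<xi>bar :: "'x::finite \<Rightarrow> real"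
  assumes "1 \<le> n" and "n \<le> CARD('x)"
    and "psd C"
    and "0 < \<kappa>" and "\<kappa> < lambda_min C"
    and "criterion \<Phi>"
    and "\<And>M. psd M \<Longrightarrow> 0 \<le> \<Phi> M"
    and "\<And>M. psd M \<Longrightarrow> \<not> invertible M \<Longrightarrow> \<Phi> M = 0"
    and "\<And>M. psd M \<Longrightarrow> invertible M \<Longrightarrow> \<exists>D. has_gradient \<Phi> D M"
    and "\<xi>bar \<in> designs n"
    and "invertible (info n \<kappa> C F \<xi>bar)"
  shows "(optimal \<Phi> n \<kappa> C F \<xi>bar \<longleftrightarrow>
      (\<forall>z :: nat \<Rightarrow> 'x. inj_on z {1..n} \<longrightarrow>
         (1 / real n) * (\<Sum>i=1..n. h \<Phi> n \<kappa> C F (z i) \<xi>bar)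
           \<le> (\<Sum>x\<in>UNIV. \<xi>bar x * h \<Phi> n \<kappa> C F x \<xi>bar)))
    \<and>
    (\<forall>\<delta>>0.
      (\<forall>z :: nat \<Rightarrow> 'x. inj_on z {1..n} \<longrightarrow>
         (1 / real n) * (\<Sum>i=1..n. h \<Phi> n \<kappa> C F (z i) \<xi>bar)
           \<le> (\<Sum>x\<in>UNIV. \<xi>bar x * h \<Phi> n \<kappa> C F x \<xi>bar) + \<delta>) \<longrightarrow>
      (\<exists>\<xi>max. optimal \<Phi> n \<kappa> C F \<xi>max \<and>
        \<Phi> (info n \<kappa> C F \<xi>bar) \<ge> \<Phi> (info n \<kappa> C F \<xi>max) - (\<kappa> / real n) * \<delta> \<and>
        (\<kappa> \<le> real n \<longrightarrow> \<Phi> (info n \<kappa> C F \<xi>bar) \<ge> \<Phi> (info n \<kappa> C F \<xi>max) - \<delta>)))"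
proof -
  define K where "K = C - \<kappa> *\<^sub>R mat 1"
  define k where "k = \<kappa> / real n"
  have K: "psd K"
    unfolding K_def using assms by (intro psd_diff_lambda_min) auto
  interpret regularized_kernel K k
    using K assms by unfold_locales (auto simp: k_def)
  have info: "info n \<kappa> C F \<xi> = transpose F ** effect \<xi> ** F" if "\<xi> \<in> designs n" for \<xi>
    unfolding K_def k_def using K that assms(1,4) by (intro info_eq_effect) (auto simp: K_def)
  have nonneg: "0 \<le> \<xi> x" if "\<xi> \<in> designs n" for \<xi> :: "'x \<Rightarrow> real" and x
    using that by (simp add: designs_def)
  have psd_info: "psd (info n \<kappa> C F \<xi>)" if "\<xi> \<in> designs n" for \<xi>
    using that by (simp add: info psd_congruence psd_effect nonneg)
  obtain D where D: "has_gradient \<Phi> D (info n \<kappa> C F \<xi>bar)"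
    using assms psd_info by blast
  define H where "H x = h \<Phi> n \<kappa> C F x \<xi>bar" for x
  have T: "T n \<kappa> C \<xi>bar = resolvent \<xi>bar"
    unfolding T_def resolvent_def system_def by (simp add: K_def k_def)
  have H: "H x = (resolvent \<xi>bar ** (F ** D ** transpose F) ** transpose (resolvent \<xi>bar)) $ x $ x" for x
    unfolding H_def h_def G_def gradient_eqI[OF psd_info[OF assms(10)] D] sandwich_diagonal T
    by simp
  define gain where "gain \<eta> = (\<Sum>x\<in>UNIV. (\<eta> x - \<xi>bar x) * H x)" for \<eta>
  have gain_eq: "gain \<eta> = (\<Sum>x\<in>UNIV. \<eta> x * H x) - (\<Sum>x\<in>UNIV. \<xi>bar x * H x)" for \<eta>
    by (simp add: gain_def left_diff_distrib sum_subtractf)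
  have upper: "\<Phi> (info n \<kappa> C F \<eta>) \<le> \<Phi> (info n \<kappa> C F \<xi>bar) + k * gain \<eta>" if "\<eta> \<in> designs n" for \<eta>
    using criterion_effect_le[OF assms(6) D[unfolded info[OF assms(10)]], of \<eta>] that assms(10)
    by (simp add: info nonneg gain_def H)
  \<comment> \<open>Stated for arbitrary \<open>\<delta>\<close>, so that
    \<open>\<delta> = 0\<close> gives sufficiency and \<open>\<delta> > 0\<close> the efficiency
    bound.\<close>
  have gap: "\<Phi> (info n \<kappa> C F \<eta>) \<le> \<Phi> (info n \<kappa> C F \<xi>bar) + k * \<delta>"
    if z: "\<forall>z :: nat \<Rightarrow> 'x. inj_on z {1..n} \<longrightarrow>
         (1 / real n) * (\<Sum>i=1..n. H (z i)) \<le> (\<Sum>x\<in>UNIV. \<xi>bar x * H x) + \<delta>"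
      and \<eta>: "\<eta> \<in> designs n" for \<eta> \<delta>
  proof -
    obtain S where S: "card S = n" "(\<Sum>x\<in>UNIV. \<eta> x * H x) \<le> 1 / real n * (\<Sum>x\<in>S. H x)"
      using capped_weights_sum_le[OF assms(1,2) \<eta>] by blast
    then obtain z where "bij_betw z {1..n} S"
      using ex_bij_betw_nat_finite_1[of S] by auto
    then have "inj_on z {1..n}" "(\<Sum>x\<in>S. H x) = (\<Sum>i=1..n. H (z i))"
      by (auto simp: bij_betw_def sum.reindex_bij_betw)
    with S(2) z have "gain \<eta> \<le> \<delta>"
      unfolding gain_eq by fastforce
    then have "k * gain \<eta> \<le> k * \<delta>"
      using k_pos by simp
    with upper[OF \<eta>] show ?thesis
      by linarith
  qed
  have necessary: "(1 / real n) * (\<Sum>i=1..n. H (z i)) \<le> (\<Sum>x\<in>UNIV. \<xi>bar x * H x)"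
    if opt: "optimal \<Phi> n \<kappa> C F \<xi>bar" and z: "inj_on z {1..n}" for z :: "nat \<Rightarrow> 'x"
  proof -
    \<comment> \<open>The uniform design on the tuple; the gain in its direction is exactly the
      difference of the two sides to be compared.\<close>
    define \<eta> where "\<eta> x = (if x \<in> z ` {1..n} then 1 / real n else 0)" for x
    have card_z: "card (z ` {1..n}) = n"
      using z by (simp add: card_image)
    have \<eta>: "\<eta> \<in> designs n"
      using assms(1) card_z by (auto simp: designs_def \<eta>_def sum.If_cases)
    \<comment> \<open>Feasibility of the segment lets optimality make all difference quotients along
      it nonpositive, hence also their limit \<open>k * gain \<eta>\<close>.\<close>
    have segment: "(\<lambda>x. \<xi>bar x + t * (\<eta> x - \<xi>bar x)) \<in> designs n" if "t \<in> {0<..<1}" for t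
    proof -
      have "\<xi>bar x + t * (\<eta> x - \<xi>bar x) = (1 - t) * \<xi>bar x + t * \<eta> x" for x
        by (simp add: algebra_simps)
      moreover have "(1 - t) * \<xi>bar x + t * \<eta> x \<le> 1 / real n" for x
        using that assms(10) \<eta> by (intro convex_bound_le) (auto simp: designs_def)
      moreover have "0 \<le> (1 - t) * \<xi>bar x + t * \<eta> x" for x
        using that assms(10) \<eta> by (simp add: nonneg)
      moreover have "(\<Sum>x\<in>UNIV. (1 - t) * \<xi>bar x + t * \<eta> x) = 1"
        using assms(10) \<eta> by (simp add: designs_def sum.distrib flip: sum_distrib_left)
      ultimately show ?thesis
        by (simp add: designs_def)
    qed
    have "\<forall>\<^sub>F t in at_right 0. (\<Phi> (transpose F ** effect (\<lambda>x. \<xi>bar x + t * (\<eta> x - \<xi>bar x)) ** F)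
        - \<Phi> (transpose F ** effect \<xi>bar ** F)) / t \<le> 0"
      unfolding eventually_at_right_field
    proof (intro exI[of _ 1] conjI allI impI)
      fix t :: real
      assume t: "0 < t" "t < 1"
      then have "\<Phi> (info n \<kappa> C F (\<lambda>x. \<xi>bar x + t * (\<eta> x - \<xi>bar x))) \<le> \<Phi> (info n \<kappa> C F \<xi>bar)"
        using opt segment by (simp add: optimal_def)
      then show "(\<Phi> (transpose F ** effect (\<lambda>x. \<xi>bar x + t * (\<eta> x - \<xi>bar x)) ** F)
          - \<Phi> (transpose F ** effect \<xi>bar ** F)) / t \<le> 0"
        using t segment assms(10) by (simp add: info divide_nonpos_pos)
    qed simp
    then have "k * gain \<eta> \<le> 0"
      unfolding gain_def H
      by (intro tendsto_upperbound[OF criterion_effect_deriv[OF D[unfolded info[OF assms(10)]]]])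
        (use assms(10) \<eta> nonneg in auto)
    then have "gain \<eta> \<le> 0"
      using k_pos by (simp add: mult_le_0_iff)
    moreover have "(\<Sum>x\<in>UNIV. \<eta> x * H x) = 1 / real n * (\<Sum>i=1..n. H (z i))"
      using z by (simp add: \<eta>_def sum.If_cases sum_distrib_left sum.reindex
          if_distrib[of "\<lambda>a. a * _"] cong: if_cong)
    ultimately show ?thesis
      by (simp add: gain_eq)
  qed
  \<comment> \<open>The designs form a compact set, and writing the information matrix through
    \<open>effect\<close> makes the criterion continuous on all of it, even where the support
    changes.\<close>
  obtain \<xi>max where max: "optimal \<Phi> n \<kappa> C F \<xi>max"
  proof -
    let ?V = "{v :: real^'x. vec_nth v \<in> designs n}"
    have "continuous_on (Collect psd) \<Phi>"
      using assms(6) by (simp add: criterion_def)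
    moreover have "continuous_on ?V (\<lambda>v. transpose F ** effect (vec_nth v) ** F)"
      by (intro continuous_on_matrix_mult continuous_on_effect continuous_on_const
          continuous_on_component continuous_on_id) (simp add: nonneg)
    ultimately have "continuous_on ?V (\<lambda>v. \<Phi> (transpose F ** effect (vec_nth v) ** F))"
      by (rule continuous_on_compose2) (auto intro!: psd_congruence psd_effect nonneg)
    moreover have "vec_lambda \<xi>bar \<in> ?V"
      using assms(10) by (simp add: vec_lambda_inverse)
    ultimately obtain v where v: "v \<in> ?V" and v_max: "\<And>u. u \<in> ?V \<Longrightarrow>
        \<Phi> (transpose F ** effect (vec_nth u) ** F) \<le> \<Phi> (transpose F ** effect (vec_nth v) ** F)"
      using continuous_attains_sup[OF compact_designs] by blast
    have "\<Phi> (info n \<kappa> C F \<eta>) \<le> \<Phi> (info n \<kappa> C F (vec_nth v))" if "\<eta> \<in> designs n" for \<eta>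
      using v_max[of "vec_lambda \<eta>"] v that by (simp add: info vec_lambda_inverse)
    with v that[of "vec_nth v"] show thesis
      by (simp add: optimal_def)
  qed
  show ?thesis
    unfolding H_def[symmetric]
  proof (intro conjI iffI allI impI)
    fix z :: "nat \<Rightarrow> 'x"
    assume "optimal \<Phi> n \<kappa> C F \<xi>bar" "inj_on z {1..n}"
    then show "(1 / real n) * (\<Sum>i=1..n. H (z i)) \<le> (\<Sum>x\<in>UNIV. \<xi>bar x * H x)"
      by (rule necessary)
  next
    assume "\<forall>z. inj_on z {1..n} \<longrightarrow>
      (1 / real n) * (\<Sum>i=1..n. H (z i)) \<le> (\<Sum>x\<in>UNIV. \<xi>bar x * H x)"
    with gap[of 0] assms(10) show "optimal \<Phi> n \<kappa> C F \<xi>bar"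
      by (simp add: optimal_def)
  next
    fix \<delta> :: real
    assume "0 < \<delta>" and "\<forall>z. inj_on z {1..n} \<longrightarrow>
      (1 / real n) * (\<Sum>i=1..n. H (z i)) \<le> (\<Sum>x\<in>UNIV. \<xi>bar x * H x) + \<delta>"
    with gap[of \<delta>] max have bound:
      "\<Phi> (info n \<kappa> C F \<xi>max) \<le> \<Phi> (info n \<kappa> C F \<xi>bar) + k * \<delta>"
      by (simp add: optimal_def)
    moreover have "k * \<delta> \<le> \<delta>" if "\<kappa> \<le> real n"
      using that \<open>0 < \<delta>\<close> assms(1) by (simp add: k_def field_simps)
    ultimately show "\<exists>\<xi>max. optimal \<Phi> n \<kappa> C F \<xi>max \<and>
        \<Phi> (info n \<kappa> C F \<xi>bar) \<ge> \<Phi> (info n \<kappa> C F \<xi>max) - (\<kappa> / real n) * \<delta> \<and>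
        (\<kappa> \<le> real n \<longrightarrow> \<Phi> (info n \<kappa> C F \<xi>bar) \<ge> \<Phi> (info n \<kappa> C F \<xi>max) - \<delta>)"
      using max by (intro exI[of _ \<xi>max]) (auto simp: k_def)
  qed
qed

end
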